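(* Let $G$ be a finite simple graph with minimum degree $\delta$, and suppose there exists a set of vertices $K = \{v_1,\dots,v_k\}$ such that the graph $G\setminus K$ (obtained by deleting the vertices of $K$) has minimum degree at least $2$ and girth at least $5$. Then $2\delta - 3k - 2 \le Z(G)$.
   Context: The girth is the length of a shortest cycle. Zero forcing process: start with an initial set $S$ of colored vertices. A colored vertex $u$ forces an uncolored neighbor $w$ (making $w$ colored) if $w$ is the only uncolored neighbor of $u$; forces are applied repeatedly. $S$ is a zero forcing set if eventually every vertex becomes colored. $Z(G)$ is the minimum size of a zero forcing set. *)

theory Defs
  imports "Graph_Theory.Digraph_Component" "HOL-Library.Extended_Nat"
begin

text \<open>
  A finite simple graph is a \<^const>\<open>graph\<close>: a finite symmetric digraph without loops and parallel
  arcs, so each edge is a pair of opposite arcs and the degree of a vertex is its out-degree.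
  The null graph gets minimum degree 0.
\<close>

definition min_degree :: "('a, 'b) pre_digraph \<Rightarrow> nat" where
  "min_degree G = (if verts G = {} then 0 else Min (out_degree G ` verts G))"

text \<open>
  Traversing an edge back and forth is a \<^const>\<open>pre_digraph.cycle\<close> of length 2 in a symmetric
  digraph; the cycles of the undirected graph are those of length at least 3.
  The girth of an acyclic graph is \<open>\<infinity>\<close>.
\<close>

definition girth :: "('a, 'b) pre_digraph \<Rightarrow> enat" where
  "girth G = (INF p \<in> {p. pre_digraph.cycle G p \<and> 3 \<le> length p}. enat (length p))"

definition delete_verts :: "('a, 'b) pre_digraph \<Rightarrow> 'a set \<Rightarrow> ('a, 'b) pre_digraph" where
  "delete_verts G K = G \<restriction> (verts G - K)"

definition forces :: "('a, 'b) pre_digraph \<Rightarrow> 'a set \<Rightarrow> 'a \<Rightarrow> 'a \<Rightarrow> bool" where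
  "forces G C u w \<longleftrightarrow> u \<in> C \<and> {x. u \<rightarrow>\<^bsub>G\<^esub> x \<and> x \<notin> C} = {w}"

definition force_step :: "('a, 'b) pre_digraph \<Rightarrow> 'a set \<Rightarrow> 'a set \<Rightarrow> bool" where
  "force_step G C C' \<longleftrightarrow> (\<exists>u w. forces G C u w \<and> C' = insert w C)"

definition zero_forcing_set :: "('a, 'b) pre_digraph \<Rightarrow> 'a set \<Rightarrow> bool" where
  "zero_forcing_set G S \<longleftrightarrow> S \<subseteq> verts G \<and> (force_step G)\<^sup>*\<^sup>* S (verts G)"

definition zero_forcing_number :: "('a, 'b) pre_digraph \<Rightarrow> nat" where
  "zero_forcing_number G = Min (card ` {S. zero_forcing_set G S})"

end

theory Submission
  imports Defs
begin

text \<open>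
  Put \<open>H = G \ K\<close>. In a graph of girth at least 5 any two distinct closed neighbourhoods together
  contain at least \<open>2 \<delta>(H)\<close> vertices. Look at the second force in \<open>G\<close> whose two ends both avoid
  \<open>K\<close>: just before it, two closed neighbourhoods of \<open>H\<close> are coloured up to one vertex. Every
  coloured vertex outside \<open>K\<close> was in the initial set, or was forced by one of the \<open>k\<close> vertices of \<open>K\<close>
  (each of which forces at most once), or was the target of the first such force. Hence the initial
  set has at least \<open>2 \<delta>(H) - k - 2\<close> elements (if there is no second such force, count all vertices
  of \<open>H\<close> at the end of the process instead), and \<open>\<delta>(H) \<ge> \<delta>(G) - k\<close>.
\<close>

section \<open>Degrees as numbers of neighbours\<close>

lemma (in digraph) out_degree_eq_card_dominated:
  "out_degree G u = card {x. u \<rightarrow>\<^bsub>G\<^esub> x}"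
proof -
  have "inj_on (head G) (out_arcs G u)"
    by (auto simp: inj_on_def out_arcs_def arc_to_ends_def intro: no_multi_arcs)
  moreover have "head G ` out_arcs G u = {x. u \<rightarrow>\<^bsub>G\<^esub> x}"
    by (auto simp: out_arcs_def arcs_ends_def arc_to_ends_def)
  ultimately show ?thesis
    unfolding out_degree_def by (metis card_image)
qed

lemma (in digraph) min_degree_le_card_dominated:
  assumes "u \<in> verts G"
  shows "min_degree G \<le> card {x. u \<rightarrow>\<^bsub>G\<^esub> x}"
  using assms unfolding min_degree_def out_degree_eq_card_dominated[symmetric] by auto

lemma (in digraph) min_degree_greatest:
  assumes "verts G \<noteq> {}" and "\<And>u. u \<in> verts G \<Longrightarrow> d \<le> card {x. u \<rightarrow>\<^bsub>G\<^esub> x}"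
  shows "d \<le> min_degree G"
  using assms unfolding min_degree_def out_degree_eq_card_dominated[symmetric] by auto

lemma (in fin_digraph) finite_dominated [simp]: "finite {x. u \<rightarrow>\<^bsub>G\<^esub> x}"
  by (rule finite_subset[OF _ finite_verts]) auto

section \<open>Short cycles and neighbourhoods under a girth bound\<close>

lemma girth_le_length:
  assumes "pre_digraph.cycle G p" and "3 \<le> length p"
  shows "girth G \<le> enat (length p)"
  unfolding girth_def using assms by (auto intro: INF_lower)

lemma (in wf_digraph) girth_le_3_if_triangle:
  assumes "a \<rightarrow>\<^bsub>G\<^esub> b" "b \<rightarrow>\<^bsub>G\<^esub> c" "c \<rightarrow>\<^bsub>G\<^esub> a" and "distinct [a, b, c]"
  shows "girth G \<le> 3"
proof -
  obtain e f g where "e \<in> arcs G" "f \<in> arcs G" "g \<in> arcs G"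
    and "tail G e = a" "head G e = b" "tail G f = b" "head G f = c" "tail G g = c" "head G g = a"
    using assms(1-3) by (auto simp: arcs_ends_def arc_to_ends_def)
  then have "cycle [e, f, g]"
    using assms(4) unfolding cycle_def awalk_def by (intro exI[of _ a]) auto
  from girth_le_length[OF this] show ?thesis
    by (simp add: numeral_eq_enat eval_nat_numeral)
qed

lemma (in wf_digraph) girth_le_4_if_square:
  assumes "a \<rightarrow>\<^bsub>G\<^esub> b" "b \<rightarrow>\<^bsub>G\<^esub> c" "c \<rightarrow>\<^bsub>G\<^esub> d" "d \<rightarrow>\<^bsub>G\<^esub> a" and "distinct [a, b, c, d]"
  shows "girth G \<le> 4"
proof -
  obtain e f g h where "e \<in> arcs G" "f \<in> arcs G" "g \<in> arcs G" "h \<in> arcs G"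
    and "tail G e = a" "head G e = b" "tail G f = b" "head G f = c"
      "tail G g = c" "head G g = d" "tail G h = d" "head G h = a"
    using assms(1-4) by (auto simp: arcs_ends_def arc_to_ends_def)
  then have "cycle [e, f, g, h]"
    using assms(5) unfolding cycle_def awalk_def by (intro exI[of _ a]) auto
  from girth_le_length[OF this] show ?thesis
    by (simp add: numeral_eq_enat eval_nat_numeral)
qed

text \<open>Inclusion-exclusion on the open neighbourhoods. If \<open>u\<close> and \<open>v\<close>
  are adjacent, a common neighbour would close a triangle, so there is no overlap. Otherwise the
  overlap is at most one vertex, and \<open>u\<close> and \<open>v\<close> themselves lie outside
  the union and more than make up for it.\<close>

lemma (in graph) card_two_closed_neighbourhoods:
  assumes girth: "girth G \<ge> 5" and uv: "u \<in> verts G" "v \<in> verts G" "u \<noteq> v"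
  shows "2 * min_degree G \<le> card ({u, v} \<union> {x. u \<rightarrow>\<^bsub>G\<^esub> x} \<union> {x. v \<rightarrow>\<^bsub>G\<^esub> x})"
proof -
  let ?N = "\<lambda>u. {x. u \<rightarrow>\<^bsub>G\<^esub> x}"
  have girth_gt: "\<not> girth G \<le> 3" "\<not> girth G \<le> 4"
    using girth by (auto simp: not_le intro: less_le_trans[of _ 5])
  have card_sum: "2 * min_degree G \<le> card (?N u \<union> ?N v) + card (?N u \<inter> ?N v)"
    using min_degree_le_card_dominated[OF uv(1)] min_degree_le_card_dominated[OF uv(2)]
      card_Un_Int[of "?N u" "?N v"] by simp
  show ?thesis
  proof (cases "u \<rightarrow>\<^bsub>G\<^esub> v")
    case True
    have "x \<notin> ?N v" if "x \<in> ?N u" for x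
      using girth_le_3_if_triangle[of u v x] girth_gt that True
      by (auto dest: graph_symmetric adj_not_same)
    then have "?N u \<inter> ?N v = {}" by auto
    moreover have "card (?N u \<union> ?N v) \<le> card ({u, v} \<union> ?N u \<union> ?N v)"
      by (intro card_mono) auto
    ultimately show ?thesis
      using card_sum by simp
  next
    case False
    \<comment> \<open>Two common neighbours would give the 4-cycle \<open>u\<close>,
      \<open>x\<close>, \<open>v\<close>, \<open>y\<close>.\<close>
    have "x = y" if "x \<in> ?N u \<inter> ?N v" "y \<in> ?N u \<inter> ?N v" for x y
    proof (rule ccontr)
      assume "x \<noteq> y"
      with that uv(3) show False
        using girth_le_4_if_square[of u x v y] girth_gt by (auto dest: graph_symmetric adj_not_same)
    qed
    then have "card (?N u \<inter> ?N v) \<le> 1"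
      by (simp add: card_le_Suc0_iff_eq)
    moreover have "{u, v} \<inter> (?N u \<union> ?N v) = {}"
      using False by (auto dest: graph_symmetric adj_not_same)
    then have "card ({u, v} \<union> (?N u \<union> ?N v)) = 2 + card (?N u \<union> ?N v)"
      using uv(3) by (subst card_Un_disjoint) auto
    ultimately show ?thesis
      using card_sum by (simp add: Un_assoc)
  qed
qed

section \<open>Deleting a vertex set\<close>

lemma verts_delete_verts [simp]: "verts (delete_verts G K) = verts G - K"
  by (simp add: delete_verts_def)

lemma dominates_delete_verts_iff:
  "u \<rightarrow>\<^bsub>delete_verts G K\<^esub> x \<longleftrightarrow> u \<in> verts G - K \<and> x \<in> verts G - K \<and> u \<rightarrow>\<^bsub>G\<^esub> x"
  by (auto simp: delete_verts_def arcs_ends_def arc_to_ends_def)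

lemma (in graph) graph_delete_verts: "graph (delete_verts G K)"
proof -
  have "induced_subgraph (delete_verts G K) G"
    unfolding delete_verts_def by (rule induced_induce) auto
  then interpret H: sym_digraph "delete_verts G K"
    by (rule induced_graph_imp_graph)
  show ?thesis
    by unfold_locales (auto simp: delete_verts_def dest: no_loops intro: no_multi_arcs)
qed

text \<open>Each surviving vertex loses only neighbours in \<open>K\<close>, hence at most
  \<open>card K\<close> of them.\<close>

lemma (in graph) min_degree_delete_verts:
  assumes "K \<subseteq> verts G" and "verts G - K \<noteq> {}"
  shows "min_degree G \<le> min_degree (delete_verts G K) + card K"
proof -
  interpret H: graph "delete_verts G K" by (rule graph_delete_verts)
  have "min_degree G - card K \<le> min_degree (delete_verts G K)"
  proof (rule H.min_degree_greatest)
    fix u assume u: "u \<in> verts (delete_verts G K)"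
    have "finite K" using assms(1) finite_verts by (rule finite_subset)
    have "{x. u \<rightarrow>\<^bsub>G\<^esub> x} \<subseteq> {x. u \<rightarrow>\<^bsub>delete_verts G K\<^esub> x} \<union> K"
      using u by (auto simp: dominates_delete_verts_iff)
    then have "card {x. u \<rightarrow>\<^bsub>G\<^esub> x} \<le> card ({x. u \<rightarrow>\<^bsub>delete_verts G K\<^esub> x} \<union> K)"
      using \<open>finite K\<close> by (intro card_mono) auto
    also have "\<dots> \<le> card {x. u \<rightarrow>\<^bsub>delete_verts G K\<^esub> x} + card K"
      by (rule card_Un_le)
    finally show "min_degree G - card K \<le> card {x. u \<rightarrow>\<^bsub>delete_verts G K\<^esub> x}"
      using min_degree_le_card_dominated[of u] u by simp
  qed (use assms in auto)
  then show ?thesis by simp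
qed

section \<open>The forcing process and the lower bound\<close>

text \<open>
  The set \<open>D\<close> collects the vertices of \<open>K\<close> that have already forced; \<open>U\<close> is empty or consists of the
  one vertex outside \<open>K\<close> that has already forced a vertex outside \<open>K\<close>.
\<close>
lemma (in graph) force_steps_invariant:
  assumes K: "K \<subseteq> verts G"
    and nbhds: "\<forall>u\<in>verts G - K. \<forall>v\<in>verts G - K. u \<noteq> v \<longrightarrow>
      m \<le> card (({u, v} \<union> {x. u \<rightarrow>\<^bsub>G\<^esub> x} \<union> {x. v \<rightarrow>\<^bsub>G\<^esub> x}) - K)"
    and S: "S \<subseteq> verts G"
    and steps: "(force_step G)\<^sup>*\<^sup>* S C"
  shows "C \<subseteq> verts G \<and> (m \<le> card S + card K + 2 \<or>
    (\<exists>D U. D \<subseteq> K \<and> U \<subseteq> C - K \<and> card U \<le> 1 \<and> card (C - K) \<le> card S + card D + card U \<and>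
      (\<forall>d\<in>D \<union> U. \<forall>x. d \<rightarrow>\<^bsub>G\<^esub> x \<longrightarrow> x \<in> C)))"
    (is "_ \<and> (?bound \<or> (\<exists>D U. ?inv C D U))")
  using steps
proof (induction rule: rtranclp_induct)
  case base
  have "finite S" using S finite_verts by (rule finite_subset)
  then have "?inv S {} {}" by (auto intro: card_mono)
  with S show ?case by blast
next
  case (step C C')
  obtain u w where "forces G C u w" and C': "C' = insert w C"
    using step.hyps(2) unfolding force_step_def by blast
  then have u: "u \<in> C" and uw: "u \<rightarrow>\<^bsub>G\<^esub> w" and w: "w \<notin> C"
    and only: "\<And>x. u \<rightarrow>\<^bsub>G\<^esub> x \<Longrightarrow> x \<in> C'"
    unfolding forces_def by blast+
  have C'_verts: "C' \<subseteq> verts G"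
    using conjunct1[OF step.IH] C' uw by auto
  have fin: "finite C" "finite K" "finite C'"
    using K C'_verts C' finite_subset[OF _ finite_verts] by auto
  have "?bound \<or> (\<exists>D U. ?inv C' D U)"
  \<comment> \<open>\<open>?bound\<close> does not mention the coloured set, so once reached it
    persists; only its failure needs work.\<close>
  proof (rule disj_imp[THEN iffD2, OF impI])
    assume "\<not> ?bound"
    with step.IH obtain D U where D: "D \<subseteq> K" and U: "U \<subseteq> C - K" "card U \<le> 1"
      and card_C: "card (C - K) \<le> card S + card D + card U"
      and closed: "\<forall>d\<in>D \<union> U. \<forall>x. d \<rightarrow>\<^bsub>G\<^esub> x \<longrightarrow> x \<in> C"
      by blast
    then have closed': "\<forall>d\<in>D \<union> U. \<forall>x. d \<rightarrow>\<^bsub>G\<^esub> x \<longrightarrow> x \<in> C'" and U': "U \<subseteq> C' - K"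
      using C' by blast+
    have fin': "finite D" "finite U"
      using D U(1) fin by (auto intro: finite_subset)
    \<comment> \<open>No vertex forces twice: all neighbours of \<open>D \<union> U\<close> are
      already coloured, but \<open>w\<close> is not.\<close>
    have uDU: "u \<notin> D \<union> U"
      using closed uw w by blast
    have card_C': "card (C' - K) \<le> card (C - K) + 1"
      using C' fin w by (simp add: insert_Diff_if)
    consider "w \<in> K" | "w \<notin> K" "u \<in> K" | "w \<notin> K" "u \<notin> K" "U = {}" | "w \<notin> K" "u \<notin> K" "U \<noteq> {}"
      by blast
    then show "\<exists>D U. ?inv C' D U"
    proof cases
      \<comment> \<open>The count outside \<open>K\<close> is unchanged, so \<open>D\<close> and
        \<open>U\<close> are kept.\<close>
      case 1
      then have "C' - K = C - K" using C' by auto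
      then show ?thesis
        using D U' U(2) card_C closed' by (intro exI[of _ D] exI[of _ U]) simp
    next
      \<comment> \<open>The new vertex \<open>w\<close> is charged to \<open>u\<close>, which joins
        \<open>D\<close>.\<close>
      case 2
      have "card (insert u D) = card D + 1" using fin' uDU by simp
      with card_C card_C' have "card (C' - K) \<le> card S + card (insert u D) + card U" by linarith
      moreover have "insert u D \<subseteq> K" using D 2 by simp
      moreover have "\<forall>d\<in>insert u D \<union> U. \<forall>x. d \<rightarrow>\<^bsub>G\<^esub> x \<longrightarrow> x \<in> C'"
        using closed' only by blast
      ultimately show ?thesis using U' U(2) by blast
    next
      \<comment> \<open>The first force with both ends outside \<open>K\<close>: \<open>U\<close>
        becomes \<open>{u}\<close>.\<close>
      case 3
      with card_C card_C' have "card (C' - K) \<le> card S + card D + card {u}" by simp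
      moreover have "{u} \<subseteq> C' - K" using 3 u C' by simp
      moreover have "\<forall>d\<in>D \<union> {u}. \<forall>x. d \<rightarrow>\<^bsub>G\<^esub> x \<longrightarrow> x \<in> C'"
        using closed' only by blast
      moreover have "card {u} \<le> 1" by simp
      ultimately show ?thesis using D by blast
    next
      \<comment> \<open>The second such force: the closed neighbourhoods of \<open>u\<close> and
        \<open>v\<close> are coloured outside \<open>K\<close>. The 2 in the bound counts
        \<open>w\<close> and the vertex charged to \<open>U\<close>, so \<open>?bound\<close> holds,
        a contradiction.\<close>
      case 4
      then obtain v where v: "v \<in> U" by blast
      have "m \<le> card (({u, v} \<union> {x. u \<rightarrow>\<^bsub>G\<^esub> x} \<union> {x. v \<rightarrow>\<^bsub>G\<^esub> x}) - K)"
      proof (rule nbhds[rule_format])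
        show "u \<in> verts G - K" "v \<in> verts G - K" using v U' 4(2) u C' C'_verts by blast+
        show "u \<noteq> v" using v uDU by blast
      qed
      also have "\<dots> \<le> card (C' - K)"
      proof (rule card_mono)
        have "u \<in> C'" "v \<in> C'" using v U' u C' by blast+
        then show "({u, v} \<union> {x. u \<rightarrow>\<^bsub>G\<^esub> x} \<union> {x. v \<rightarrow>\<^bsub>G\<^esub> x}) - K \<subseteq> C' - K"
          using v closed' only by blast
      qed (use fin in simp)
      also have "\<dots> \<le> card S + card D + 2"
        using card_C' card_C U(2) by linarith
      also have "\<dots> \<le> card S + card K + 2"
        using D fin by (simp add: card_mono)
      finally show ?thesis using \<open>\<not> ?bound\<close> by blast
    qed
  qed
  with C'_verts show ?case by blast
qed

text \<open>The invariant is read off at the end of the process, with \<open>m\<close> twice the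
  minimum degree after deletion. The degree hypothesis supplies two distinct vertices outside
  \<open>K\<close>, so that \<open>verts G - K\<close> itself has at least \<open>m\<close>
  elements.\<close>

lemma (in graph) zero_forcing_set_lower_bound:
  assumes K: "K \<subseteq> verts G"
    and deg: "min_degree (delete_verts G K) \<ge> 2"
    and girth: "girth (delete_verts G K) \<ge> 5"
    and S: "zero_forcing_set G S"
  shows "2 * min_degree (delete_verts G K) \<le> card S + card K + 2"
proof -
  let ?H = "delete_verts G K"
  interpret H: graph ?H by (rule graph_delete_verts)
  have fin: "finite K" using K finite_verts by (rule finite_subset)
  have nbhds: "2 * min_degree ?H \<le> card (({u, v} \<union> {x. u \<rightarrow>\<^bsub>G\<^esub> x} \<union> {x. v \<rightarrow>\<^bsub>G\<^esub> x}) - K)"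
    if "u \<in> verts G - K" "v \<in> verts G - K" "u \<noteq> v" for u v
  proof -
    have "({u, v} \<union> {x. u \<rightarrow>\<^bsub>G\<^esub> x} \<union> {x. v \<rightarrow>\<^bsub>G\<^esub> x}) - K =
      {u, v} \<union> {x. u \<rightarrow>\<^bsub>?H\<^esub> x} \<union> {x. v \<rightarrow>\<^bsub>?H\<^esub> x}"
      using that by (auto simp: dominates_delete_verts_iff)
    then show ?thesis
      using H.card_two_closed_neighbourhoods[OF girth, of u v] that by simp
  qed
  \<comment> \<open>The null graph has \<open>min_degree\<close> 0, which \<open>deg\<close>
    excludes.\<close>
  obtain u where u: "u \<in> verts G - K"
    using deg unfolding min_degree_def by (auto split: if_splits)
  then have "0 < card {x. u \<rightarrow>\<^bsub>?H\<^esub> x}"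
    using order_trans[OF deg H.min_degree_le_card_dominated[of u]] by simp
  then obtain v where "u \<rightarrow>\<^bsub>?H\<^esub> v"
    by (auto simp: card_gt_0_iff)
  then have v: "v \<in> verts G - K" "u \<noteq> v"
    by (auto simp: dominates_delete_verts_iff dest: adj_not_same)
  have verts_bound: "2 * min_degree ?H \<le> card (verts G - K)"
    by (rule order_trans[OF nbhds[OF u v]]) (rule card_mono, use u v in auto)
  have S_verts: "S \<subseteq> verts G" and steps: "(force_step G)\<^sup>*\<^sup>* S (verts G)"
    using S unfolding zero_forcing_set_def by simp_all
  have "\<forall>u\<in>verts G - K. \<forall>v\<in>verts G - K. u \<noteq> v \<longrightarrow>
      2 * min_degree ?H \<le> card (({u, v} \<union> {x. u \<rightarrow>\<^bsub>G\<^esub> x} \<union> {x. v \<rightarrow>\<^bsub>G\<^esub> x}) - K)"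
    using nbhds by blast
  \<comment> \<open>If the bound was not reached during the process, all of
    \<open>verts G - K\<close> is counted by \<open>S\<close>, \<open>D\<close> and
    \<open>U\<close>.\<close>
  from force_steps_invariant[OF K this S_verts steps, THEN conjunct2] show ?thesis
  proof (elim disjE exE conjE)
    fix D U :: "'a set"
    assume "D \<subseteq> K" "card U \<le> 1" "card (verts G - K) \<le> card S + card D + card U"
    moreover have "card D \<le> card K"
      using fin \<open>D \<subseteq> K\<close> by (rule card_mono)
    ultimately show ?thesis
      using verts_bound by linarith
  qed
qed

lemma (in graph) zero_forcing_number_attained:
  obtains S where "zero_forcing_set G S" and "card S = zero_forcing_number G"
proof -
  have "finite {S. zero_forcing_set G S}"
    by (rule finite_subset[of _ "Pow (verts G)"]) (auto simp: zero_forcing_set_def)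
  moreover have "zero_forcing_set G (verts G)"
    by (simp add: zero_forcing_set_def)
  ultimately have "zero_forcing_number G \<in> card ` {S. zero_forcing_set G S}"
    unfolding zero_forcing_number_def by (intro Min_in) auto
  then show thesis using that by auto
qed

theorem theorem7:
  fixes G :: "('a, 'b) pre_digraph" and K :: "'a set"
  assumes "graph G"
    and "K \<subseteq> verts G"
    and "min_degree (delete_verts G K) \<ge> 2"
    and "girth (delete_verts G K) \<ge> 5"
  shows "2 * int (min_degree G) - 3 * int (card K) - 2 \<le> int (zero_forcing_number G)"
proof -
  interpret graph G by fact
  obtain S where S: "zero_forcing_set G S" "card S = zero_forcing_number G"
    by (rule zero_forcing_number_attained)
  have "verts G - K \<noteq> {}"
    using assms(3) by (auto simp: min_degree_def)
  then have "min_degree G \<le> min_degree (delete_verts G K) + card K"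
    using assms(2) by (rule min_degree_delete_verts[rotated])
  moreover have "2 * min_degree (delete_verts G K) \<le> zero_forcing_number G + card K + 2"
    using zero_forcing_set_lower_bound[OF assms(2-4) S(1)] S(2) by simp
  \<comment> \<open>The coefficient 3 is 2 from doubling the degree loss \<open>card K\<close>, plus
    1 from the forces made by \<open>K\<close>.\<close>
  ultimately show ?thesis by linarith
qed

end
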